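(* Let $(\mathfrak h,W)$ be one of the five pairs $(0,\mathbb C)$, $(\mathfrak{sl}_3,S^2\mathbb C^3)$, $(\mathfrak{sl}_3\times\mathfrak{sl}_3,\mathbb C^3\otimes\mathbb C^3)$, $(\mathfrak{sl}_6,\Lambda^2\mathbb C^6)$, $(\mathfrak e_6,\mathbb C^{27})$, let $\mathfrak g=\mathfrak h\oplus\mathbb C\oplus W\oplus W^*$ (respectively $\mathfrak{sl}_2,\mathfrak{sp}_6,\mathfrak{sl}_6,\mathfrak{so}_{12},\mathfrak e_7$) and let $V=\mathbb C\oplus W\oplus W^*\oplus\mathbb C^*$ be the associated simple $\mathfrak g$-module. Then the quartic polynomial defined for $w=(\alpha,r,s^*,\beta^* )\in V$ by $$Q(w)=\Big(3\alpha\beta^*-\tfrac12\langle r,s^*\rangle\Big)^2+\tfrac13\big(\beta^*C(r^3)+\alpha C^*(s^{*3})\big)-\tfrac16\langle C^*(s^{*2}),C(r^2)\rangle$$ is a $\mathfrak g$-invariant form on $V$.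
   Context: $C\in S^3W^*$ is a nonzero $\mathfrak h$-invariant cubic form on $W$ and $C^*\in S^3W$ a dual $\mathfrak h$-invariant cubic on $W^*$. $C(rst)$ is the value of the symmetric trilinear form, $C(rs)=C(r,s,\cdot)\in W^*$, $C(r^2)=C(rr)$, $C(r^3)=C(rrr)$, and similarly $C^*(r^*s^* )\in W$ etc.; $\langle\cdot,\cdot\rangle$ is the duality pairing of $W$ and $W^*$ (in either order). The action of $\mathfrak g$ on $V$: $\mathfrak h$ acts naturally on each summand (trivially on $\mathbb C$ and $\mathbb C^*$); $1\in\mathbb C$ acts by multiplication by $-\frac32,-\frac12,\frac12,\frac32$ on the four summands $\mathbb C,W,W^*,\mathbb C^*$; $t\in W$ and $t^*\in W^*$ act by $$t.(\alpha,r,s^*,\beta^* )=(0,\,3\alpha t,\,C(rt),\,\tfrac12\langle t,s^*\rangle),\qquad t^*.(\alpha,r,s^*,\beta^* )=(\tfrac12\langle r,t^*\rangle,\,C^*(s^*t^* ),\,3\beta^*t^*,\,0).$$ Normalization convention: let $\theta:W\otimes W^*\to\mathfrak h$ be (a multiple of) the map dual to the action of $\mathfrak h$ on $W$. Then $\theta,C,C^*$ are normalized such that for all $r,s\in W$, $t^*\in W^*$: $$\theta(r\otimes t^* )s-\theta(s\otimes t^* )r=\langle s,t^*\rangle r-\langle r,t^*\rangle s,$$ $$\theta(r\otimes t^* )s+\theta(s\otimes t^* )r=2(\langle s,t^*\rangle r+\langle r,t^*\rangle s)-2C^*(t^*C(rs)).$$ A polynomial is $\mathfrak g$-invariant if it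 is annihilated by the induced action of $\mathfrak g$ by derivations. *)

theory Defs
  imports "HOL-Analysis.Analysis"
begin

section \<open>Complex vector spaces\<close>

class complex_vector = ab_group_add +
  fixes scaleC :: "complex \<Rightarrow> 'a \<Rightarrow> 'a"  (infixr \<open>*C\<close> 75)
  assumes scaleC_add_right: "a *C (x + y) = a *C x + a *C y"
    and scaleC_add_left: "(a + b) *C x = a *C x + b *C x"
    and scaleC_scaleC: "a *C b *C x = (a * b) *C x"
    and scaleC_one: "1 *C x = x"

interpretation cvs: vector_space "scaleC :: complex \<Rightarrow> 'a \<Rightarrow> 'a::complex_vector"
  by unfold_locales
    (simp_all add: scaleC_add_right scaleC_add_left scaleC_scaleC scaleC_one)

instantiation complex :: complex_vector
begin
definition scaleC_complex_def [simp]: "a *C (z::complex) = a * z"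
instance by standard (simp_all add: algebra_simps)
end

instantiation prod :: (complex_vector, complex_vector) complex_vector
begin
definition scaleC_prod_def: "a *C v = (a *C fst v, a *C snd v)"
instance by standard
    (simp_all add: scaleC_prod_def scaleC_add_right scaleC_add_left scaleC_scaleC scaleC_one)
end

instantiation vec :: (complex_vector, finite) complex_vector
begin
definition scaleC_vec_def: "a *C v = (\<chi> i. a *C (v $ i))"
instance by standard
    (simp_all add: scaleC_vec_def vec_eq_iff scaleC_add_right scaleC_add_left
      scaleC_scaleC scaleC_one)
end

abbreviation clinear :: "('a::complex_vector \<Rightarrow> 'b::complex_vector) \<Rightarrow> bool"
  where "clinear \<equiv> Vector_Spaces.linear scaleC scaleC"

definition cbilinear :: "('a::complex_vector \<Rightarrow> 'b::complex_vector \<Rightarrow> 'c::complex_vector) \<Rightarrow> bool"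
  where "cbilinear f \<longleftrightarrow> (\<forall>x. clinear (f x)) \<and> (\<forall>y. clinear (\<lambda>x. f x y))"

(* Meaningful for finite-dimensional spaces, where it does not depend on the chosen basis. *)
definition ctrace :: "('a::complex_vector \<Rightarrow> 'a) \<Rightarrow> complex"
  where "ctrace f = (let B = cvs.extend_basis {} in \<Sum>b\<in>B. cvs.representation B (f b) b)"


section \<open>Lie algebras and modules\<close>

definition lie_algebra :: "('h::complex_vector \<Rightarrow> 'h \<Rightarrow> 'h) \<Rightarrow> bool"
  where "lie_algebra br \<longleftrightarrow> cbilinear br \<and> (\<forall>X. br X X = 0) \<and>
    (\<forall>X Y Z. br X (br Y Z) + br Y (br Z X) + br Z (br X Y) = 0)"

definition lie_module ::
  "('h::complex_vector \<Rightarrow> 'h \<Rightarrow> 'h) \<Rightarrow> ('h \<Rightarrow> 'w::complex_vector \<Rightarrow> 'w) \<Rightarrow> bool"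
  where "lie_module br act \<longleftrightarrow> cbilinear act \<and>
    (\<forall>X Y w. act (br X Y) w = act X (act Y w) - act Y (act X w))"

definition irreducible_module :: "('h \<Rightarrow> 'w::complex_vector \<Rightarrow> 'w) \<Rightarrow> bool"
  where "irreducible_module act \<longleftrightarrow> (UNIV :: 'w set) \<noteq> {0} \<and>
    (\<forall>U. cvs.subspace U \<and> (\<forall>X. \<forall>u\<in>U. act X u \<in> U) \<longrightarrow> U = {0} \<or> U = UNIV)"

definition killing_form :: "('h::complex_vector \<Rightarrow> 'h \<Rightarrow> 'h) \<Rightarrow> 'h \<Rightarrow> 'h \<Rightarrow> complex"
  where "killing_form br X Y = ctrace (br X \<circ> br Y)"


section \<open>The five pairs\<close>

(* The pair of a Lie algebra and a module is isomorphic to the model with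
   underlying spaces H, W, bracket brM and action actM. *)
definition pair_iso ::
  "('h::complex_vector \<Rightarrow> 'h \<Rightarrow> 'h) \<Rightarrow> ('h \<Rightarrow> 'w::complex_vector \<Rightarrow> 'w) \<Rightarrow>
   'a::complex_vector set \<Rightarrow> ('a \<Rightarrow> 'a \<Rightarrow> 'a) \<Rightarrow>
   'b::complex_vector set \<Rightarrow> ('a \<Rightarrow> 'b \<Rightarrow> 'b) \<Rightarrow> bool"
  where "pair_iso br act H brM W actM \<longleftrightarrow>
    (\<exists>\<phi> \<psi>. clinear \<phi> \<and> bij_betw \<phi> UNIV H \<and> clinear \<psi> \<and> bij_betw \<psi> UNIV W \<and>
      (\<forall>X Y. \<phi> (br X Y) = brM (\<phi> X) (\<phi> Y)) \<and>
      (\<forall>X w. \<psi> (act X w) = actM (\<phi> X) (\<psi> w)))"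

definition sl :: "(complex^'n^'n) set"
  where "sl = {A. trace A = 0}"

definition commutator :: "complex^'n^'n \<Rightarrow> complex^'n^'n \<Rightarrow> complex^'n^'n"
  where "commutator A B = A ** B - B ** A"

(* Action on C^n \<otimes> C^n, with e_i \<otimes> e_j identified with the elementary matrix E_ij; the
   symmetric and exterior squares are the symmetric and skew-symmetric matrices. *)
definition tensor_act ::
  "complex^'n^'n \<Rightarrow> complex^'n^'n \<Rightarrow> complex^'n^'n \<Rightarrow> complex^'n^'n"
  where "tensor_act A B M = A ** M + M ** transpose B"

(* Bourbaki labelling of the Dynkin diagram: 1-3-4-5-6 with 2 attached to 4. *)
definition cartan_E6 :: "nat \<Rightarrow> nat \<Rightarrow> int"
  where "cartan_E6 i j =
    (if i = j then 2
     else if {i, j} \<in> {{1, 3}, {3, 4}, {4, 5}, {5, 6}, {2, 4}} then -1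
     else 0)"

(* The Lie algebra presented by the Chevalley-Serre generators and relations is the simple
   Lie algebra of type E6 (Serre); being simple, it is its own only nonzero quotient. Hence a
   nonzero Lie algebra generated by elements satisfying the relations is e_6. *)
definition is_e6 :: "('h::complex_vector \<Rightarrow> 'h \<Rightarrow> 'h) \<Rightarrow> bool"
  where "is_e6 br \<longleftrightarrow> lie_algebra br \<and> (UNIV :: 'h set) \<noteq> {0} \<and>
    (\<exists>(e :: nat \<Rightarrow> 'h) (f :: nat \<Rightarrow> 'h) (h :: nat \<Rightarrow> 'h).
      (\<forall>i\<in>{1..6}. \<forall>j\<in>{1..6}.
         br (h i) (h j) = 0 \<and>
         br (e i) (f j) = (if i = j then h i else 0) \<and>
         br (h i) (e j) = of_int (cartan_E6 i j) *C e j \<and>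
         br (h i) (f j) = - (of_int (cartan_E6 i j) *C f j) \<and>
         (i \<noteq> j \<longrightarrow>
            ((br (e i)) ^^ nat (1 - cartan_E6 i j)) (e j) = 0 \<and>
            ((br (f i)) ^^ nat (1 - cartan_E6 i j)) (f j) = 0)) \<and>
      (\<forall>S. cvs.subspace S \<and> (\<forall>X\<in>S. \<forall>Y\<in>S. br X Y \<in> S) \<and>
         e ` {1..6} \<subseteq> S \<and> f ` {1..6} \<subseteq> S \<longrightarrow> S = UNIV))"

(* The five pairs, up to isomorphism, in the order (0, C), (sl_3, S^2 C^3),
   (sl_3 x sl_3, C^3 \<otimes> C^3), (sl_6, Lambda^2 C^6), (e_6, C^27). The Lie algebra e_6 has exactly
   two irreducible modules of dimension 27; they are dual to each other and exchanged by
   the outer automorphism, so the last pair is unique up to isomorphism. *)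
definition freudenthal_pair ::
  "('h::complex_vector \<Rightarrow> 'h \<Rightarrow> 'h) \<Rightarrow> ('h \<Rightarrow> 'w::complex_vector \<Rightarrow> 'w) \<Rightarrow> bool"
  where "freudenthal_pair br act \<longleftrightarrow> lie_algebra br \<and> lie_module br act \<and>
    (pair_iso br act {0::complex} (\<lambda>_ _. 0) (UNIV :: complex set) (\<lambda>_ _. 0) \<or>
     pair_iso br act (sl :: (complex^3^3) set) commutator
       {M :: complex^3^3. transpose M = M} (\<lambda>A. tensor_act A A) \<or>
     pair_iso br act ((sl :: (complex^3^3) set) \<times> (sl :: (complex^3^3) set))
       (\<lambda>X Y. (commutator (fst X) (fst Y), commutator (snd X) (snd Y)))
       (UNIV :: (complex^3^3) set) (\<lambda>X. tensor_act (fst X) (snd X)) \<or>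
     pair_iso br act (sl :: (complex^6^6) set) commutator
       {M :: complex^6^6. transpose M = - M} (\<lambda>A. tensor_act A A) \<or>
     (is_e6 br \<and> irreducible_module act \<and> cvs.dim (UNIV :: 'w set) = 27))"


section \<open>Duality and cubic forms\<close>

(* The type 'd plays the role of the dual space W*, with p the duality pairing. *)
definition perfect_pairing :: "('w::complex_vector \<Rightarrow> 'd::complex_vector \<Rightarrow> complex) \<Rightarrow> bool"
  where "perfect_pairing p \<longleftrightarrow> cbilinear p \<and>
    (\<forall>l. clinear l \<longrightarrow> (\<exists>!d. \<forall>w. p w d = l w)) \<and>
    (\<forall>l. clinear l \<longrightarrow> (\<exists>!w. \<forall>d. p w d = l d))"

definition dual_act ::
  "('w \<Rightarrow> 'd \<Rightarrow> complex) \<Rightarrow> ('h \<Rightarrow> 'w \<Rightarrow> 'w) \<Rightarrow> 'h \<Rightarrow> 'd \<Rightarrow> 'd"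
  where "dual_act p act X d = (THE d'. \<forall>w. p w d' = - p (act X w) d)"

definition symmetric_trilinear ::
  "('w::complex_vector \<Rightarrow> 'w \<Rightarrow> 'w \<Rightarrow> complex) \<Rightarrow> bool"
  where "symmetric_trilinear C \<longleftrightarrow> (\<forall>r s. clinear (C r s)) \<and>
    (\<forall>r s u. C r s u = C s r u \<and> C r s u = C r u s)"

definition invariant_cubic ::
  "('h \<Rightarrow> 'w \<Rightarrow> 'w) \<Rightarrow> ('w \<Rightarrow> 'w \<Rightarrow> 'w \<Rightarrow> complex) \<Rightarrow> bool"
  where "invariant_cubic act C \<longleftrightarrow>
    (\<forall>X r s u. C (act X r) s u + C r (act X s) u + C r s (act X u) = 0)"

(* C(rs) in W*, for a cubic C on W. *)
definition lower ::
  "('w \<Rightarrow> 'd \<Rightarrow> complex) \<Rightarrow> ('w \<Rightarrow> 'w \<Rightarrow> 'w \<Rightarrow> complex) \<Rightarrow> 'w \<Rightarrow> 'w \<Rightarrow> 'd"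
  where "lower p C r s = (THE d. \<forall>u. p u d = C r s u)"

(* C*(rs) in W, for a cubic C* on W*. *)
definition raise ::
  "('w \<Rightarrow> 'd \<Rightarrow> complex) \<Rightarrow> ('d \<Rightarrow> 'd \<Rightarrow> 'd \<Rightarrow> complex) \<Rightarrow> 'd \<Rightarrow> 'd \<Rightarrow> 'w"
  where "raise p Cs r s = (THE w. \<forall>u. p w u = Cs r s u)"

(* th is a multiple of the map W \<otimes> W* \<rightarrow> h* dual to the action h \<otimes> W \<rightarrow> W, where h* is
   identified with h by means of the Killing form. *)
definition dual_to_action ::
  "('h::complex_vector \<Rightarrow> 'h \<Rightarrow> 'h) \<Rightarrow> ('h \<Rightarrow> 'w::complex_vector \<Rightarrow> 'w) \<Rightarrow>
   ('w \<Rightarrow> 'd::complex_vector \<Rightarrow> complex) \<Rightarrow> ('w \<Rightarrow> 'd \<Rightarrow> 'h) \<Rightarrow> bool"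
  where "dual_to_action br act p th \<longleftrightarrow> cbilinear th \<and>
    (\<exists>c. \<forall>X r t. killing_form br X (th r t) = c * p (act X r) t)"

definition normalized ::
  "('h \<Rightarrow> 'w::complex_vector \<Rightarrow> 'w) \<Rightarrow> ('w \<Rightarrow> 'd \<Rightarrow> complex) \<Rightarrow> ('w \<Rightarrow> 'w \<Rightarrow> 'w \<Rightarrow> complex) \<Rightarrow>
   ('d \<Rightarrow> 'd \<Rightarrow> 'd \<Rightarrow> complex) \<Rightarrow> ('w \<Rightarrow> 'd \<Rightarrow> 'h) \<Rightarrow> bool"
  where "normalized act p C Cs th \<longleftrightarrow> (\<forall>r s t.
    act (th r t) s - act (th s t) r = p s t *C r - p r t *C s \<and>
    act (th r t) s + act (th s t) r =
      2 *C (p s t *C r + p r t *C s) - 2 *C raise p Cs t (lower p C r s))"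


section \<open>Invariant forms\<close>

(* Homogeneous polynomial functions of degree k, i.e. the elements of S^k V*. *)
inductive form :: "nat \<Rightarrow> ('v::complex_vector \<Rightarrow> complex) \<Rightarrow> bool" where
  const: "form 0 (\<lambda>_. c)"
| linear: "clinear l \<Longrightarrow> form 1 l"
| add: "form k P \<Longrightarrow> form k Q \<Longrightarrow> form k (\<lambda>v. P v + Q v)"
| mult: "form j P \<Longrightarrow> form k Q \<Longrightarrow> form (j + k) (\<lambda>v. P v * Q v)"

(* The derivation of the polynomial functions on V induced by the linear operator A on V; the
   lemmas below show that it extends the contragredient action on V* and obeys Leibniz' rule,
   which characterizes it. *)
definition induced_derivation ::
  "('v::complex_vector \<Rightarrow> 'v) \<Rightarrow> ('v \<Rightarrow> complex) \<Rightarrow> 'v \<Rightarrow> complex"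
  where "induced_derivation A P v = - deriv (\<lambda>\<epsilon>. P (v + \<epsilon> *C A v)) 0"

lemma form_field_differentiable:
  assumes "form k P"
  shows "(\<lambda>\<epsilon>. P (v + \<epsilon> *C u)) field_differentiable at 0"
  using assms
proof induction
  case (linear l)
  then interpret Vector_Spaces.linear scaleC scaleC l .
  show ?case by (auto simp: add scale intro!: derivative_intros)
qed (auto intro!: derivative_intros)

lemma induced_derivation_const: "induced_derivation A (\<lambda>_. c) v = 0"
  by (simp add: induced_derivation_def)

lemma induced_derivation_linear:
  assumes "clinear l"
  shows "induced_derivation A l v = - l (A v)"
proof -
  interpret Vector_Spaces.linear scaleC scaleC l by (fact assms)
  have "((\<lambda>\<epsilon>. l (v + \<epsilon> *C A v)) has_field_derivative l (A v)) (at 0)"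
    by (auto simp: add scale intro!: derivative_eq_intros)
  then show ?thesis by (simp add: induced_derivation_def DERIV_imp_deriv)
qed

lemma induced_derivation_add:
  assumes "form j P" "form k Q"
  shows "induced_derivation A (\<lambda>v. P v + Q v) v
    = induced_derivation A P v + induced_derivation A Q v"
  using assms[THEN form_field_differentiable]
  by (simp add: induced_derivation_def)

lemma induced_derivation_mult:
  assumes "form j P" "form k Q"
  shows "induced_derivation A (\<lambda>v. P v * Q v) v
    = induced_derivation A P v * Q v + P v * induced_derivation A Q v"
  using assms[THEN form_field_differentiable]
  by (simp add: induced_derivation_def algebra_simps)

definition invariant_form ::
  "('g \<Rightarrow> 'v::complex_vector \<Rightarrow> 'v) \<Rightarrow> nat \<Rightarrow> ('v \<Rightarrow> complex) \<Rightarrow> bool"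
  where "invariant_form act k P \<longleftrightarrow>
    form k P \<and> (\<forall>x v. induced_derivation (act x) P v = 0)"


section \<open>The Lie algebra g, its module V and the quartic form\<close>

type_synonym ('h, 'w, 'd) g = "'h \<times> complex \<times> 'w \<times> 'd"
type_synonym ('w, 'd) V = "complex \<times> 'w \<times> 'd \<times> complex"

fun g_act ::
  "('h \<Rightarrow> 'w::complex_vector \<Rightarrow> 'w) \<Rightarrow> ('w \<Rightarrow> 'd::complex_vector \<Rightarrow> complex) \<Rightarrow>
   ('w \<Rightarrow> 'w \<Rightarrow> 'w \<Rightarrow> complex) \<Rightarrow> ('d \<Rightarrow> 'd \<Rightarrow> 'd \<Rightarrow> complex) \<Rightarrow>
   ('h, 'w, 'd) g \<Rightarrow> ('w, 'd) V \<Rightarrow> ('w, 'd) V"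
  where "g_act act p C Cs (X, z, t, t') (\<alpha>, r, s, \<beta>) =
    (0, act X r, dual_act p act X s, 0)
    + z *C (- (3/2) * \<alpha>, (- (1/2)) *C r, (1/2) *C s, 3/2 * \<beta>)
    + (0, (3 * \<alpha>) *C t, lower p C r t, 1/2 * p t s)
    + (1/2 * p r t', raise p Cs s t', (3 * \<beta>) *C t', 0)"

(* The Lie bracket of g; that V is a g-module is g_act_bracket. The element 1 of the summand C
   acts on W and W* by 1 and -1. *)
fun g_bracket ::
  "('h::complex_vector \<Rightarrow> 'h \<Rightarrow> 'h) \<Rightarrow> ('h \<Rightarrow> 'w::complex_vector \<Rightarrow> 'w) \<Rightarrow>
   ('w \<Rightarrow> 'd::complex_vector \<Rightarrow> complex) \<Rightarrow> ('w \<Rightarrow> 'd \<Rightarrow> 'h) \<Rightarrow>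
   ('h, 'w, 'd) g \<Rightarrow> ('h, 'w, 'd) g \<Rightarrow> ('h, 'w, 'd) g"
  where "g_bracket br act p th (X, x, t, t') (Y, y, s, s') =
    (br X Y + th t s' - th s t',
     p t s' - p s t',
     act X s - act Y t + x *C s - y *C t,
     dual_act p act X s' - dual_act p act Y t' - x *C s' + y *C t')"

lemma clinearD:
  assumes "clinear f"
  shows "f (x + y) = f x + f y" "f (c *C x) = c *C f x" "f (x - y) = f x - f y" "f 0 = 0" "f (- x) = - f x"
proof -
  interpret Vector_Spaces.linear scaleC scaleC f by fact
  show "f (x + y) = f x + f y" "f (c *C x) = c *C f x" "f (x - y) = f x - f y" "f 0 = 0" "f (- x) = - f x"
    by (simp_all add: add scale diff zero neg)
qed

lemma add_self_eq: assumes "a - b = (c::'a::ab_group_add)" "a + b = d" shows "a + a = c + d"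
  using assms by (auto simp: algebra_simps)

lemma add3_eq_0: assumes "a + b + c = (0::complex)" shows "c = - a - b"
proof -
  have "c = (a + b + c) - a - b" by simp
  then show ?thesis using assms by simp
qed

lemma theta_aux: assumes "x + x = B - A + (2*(B+A) - 2*(E::complex))" shows "x = 1/2*A+3/2*B - E"
proof -
  have "2 * x = 2 * (1/2*A+3/2*B - E)" using assms by (simp add: algebra_simps)
  then show ?thesis by (metis mult_left_cancel zero_neq_numeral)
qed

lemma g_act_bracket:
  fixes br :: "'h::complex_vector \<Rightarrow> 'h \<Rightarrow> 'h"
    and act :: "'h \<Rightarrow> 'w::complex_vector \<Rightarrow> 'w"
    and p :: "'w \<Rightarrow> 'd::complex_vector \<Rightarrow> complex"
  assumes "lie_module br act" and pp: "perfect_pairing p"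
    and C: "symmetric_trilinear C" and iC: "invariant_cubic act C"
    and Cs: "symmetric_trilinear Cs" and iCs: "invariant_cubic (dual_act p act) Cs"
    and nm: "normalized act p C Cs th"
  shows "g_act act p C Cs (g_bracket br act p th x y) v =
    g_act act p C Cs x (g_act act p C Cs y v) - g_act act p C Cs y (g_act act p C Cs x v)"
proof -
  have la: "clinear (act X)" "clinear (\<lambda>X. act X w)"
    and br: "act (br X Y) w = act X (act Y w) - act Y (act X w)" for X Y w
    using assms(1) by (auto simp: lie_module_def cbilinear_def)
  have lp: "clinear (p w)" "clinear (\<lambda>w. p w d)" for w d
    using pp by (auto simp: perfect_pairing_def cbilinear_def)
  have exd: "clinear l \<Longrightarrow> \<exists>!d. \<forall>w. p w d = l w"
   and exw: "clinear l' \<Longrightarrow> \<exists>!w. \<forall>d. p w d = l' d" for l l'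
    using pp by (auto simp: perfect_pairing_def)
  have zd: "clinear (\<lambda>_::'w. 0::complex)" "clinear (\<lambda>_::'d. 0::complex)"
    by (unfold_locales; simp)+
  have eqd: "d = d'" if "\<And>w. p w d = p w d'" for d d'
    using exd[OF lp(2)[of d]] that by metis
  have eqw: "w = w'" if "\<And>d. p w d = p w' d" for w w'
    using exw[OF lp(1)[of w]] that by metis
  have lC: "clinear (C r s)" for r s using C by (auto simp: symmetric_trilinear_def)
  have lCs: "clinear (Cs r s)" for r s using Cs by (auto simp: symmetric_trilinear_def)
  have sC: "C r s u = C s r u" "C r s u = C r u s" for r s u
    using C by (simp_all add: symmetric_trilinear_def)
  have sCs: "Cs r s u = Cs s r u" "Cs r s u = Cs r u s" for r s u
    using Cs by (simp_all add: symmetric_trilinear_def)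
  have lC': "clinear (\<lambda>s. C r s u)" "clinear (\<lambda>r. C r s u)" for r s u
    using lC[of r u] lC[of s u] by - (simp_all only: sC(2)[of r _ u] sC(1)[of _ s u] sC(2)[of s _ u])
  have lCs': "clinear (\<lambda>s. Cs r s u)" "clinear (\<lambda>r. Cs r s u)" for r s u
    using lCs[of r u] lCs[of s u] by - (simp_all only: sCs(2)[of r _ u] sCs(1)[of _ s u] sCs(2)[of s _ u])
  have low: "p u (lower p C r s) = C r s u" for u r s
    using theI'[OF exd[OF lC[of r s]]] by (simp add: lower_def)
  have rai: "p (raise p Cs r s) u = Cs r s u" for u r s
    using theI'[OF exw[OF lCs[of r s]]] by (simp add: raise_def)
  have "clinear (\<lambda>w. - p (act X w) d)" for X d
    by (unfold_locales; simp add: clinearD[OF la(1)] clinearD[OF lp(2)])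
  then have dact: "p w (dual_act p act X d) = - p (act X w) d" for w X d
    using theI'[OF exd[of "\<lambda>w. - p (act X w) d"]] by (simp add: dual_act_def)
  have "act (th r t) s + act (th r t) s = (p s t *C r - p r t *C s) + (2 *C (p s t *C r + p r t *C s) - 2 *C raise p Cs t (lower p C r s))" for r s t
    using nm[unfolded normalized_def, rule_format, of r t s] by (metis add_self_eq)
  then have x2: "p (act (th r t) s + act (th r t) s) u = p ((p s t *C r - p r t *C s) + (2 *C (p s t *C r + p r t *C s) - 2 *C raise p Cs t (lower p C r s))) u" for r s t u
    by simp
  then have th: "p (act (th r t) s) u = 1/2 * (p r t * p s u) + 3/2 * (p s t * p r u) - Cs t (lower p C r s) u" for r s t u
    
  proof -
    have "p (act (th r t) s) u + p (act (th r t) s) u = p s t * p r u - p r t * p s u + (2 * (p s t * p r u + p r t * p s u) - 2 * Cs t (lower p C r s) u)" for r s t u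
      using x2[of r t s u] unfolding clinearD[OF lp(2)] rai scaleC_complex_def .
    from theta_aux[OF this[of r t s u]] show ?thesis .
  qed
  have cl: "Cs (lower p C r s) t u = p (raise p Cs t u) (lower p C r s)" for r s t u
    by (simp only: rai sCs(1)[of "lower p C r s"] sCs(2)[of t "lower p C r s"])
  have cl': "C (raise p Cs r s) t u = p (raise p Cs r s) (lower p C t u)" for r s t u
    by (simp only: low sC(1)[of "raise p Cs r s"] sC(2)[of t "raise p Cs r s"])
  have c1: "Cs t (lower p C r s) u = C r s (raise p Cs t u)" for r s t u
    by (simp only: low[symmetric] rai sCs(2)[of t u])
  have c2: "Cs t u (lower p C r s) = C r s (raise p Cs t u)" for r s t u
    by (simp only: low[symmetric] rai)
  have c3: "p (act X (raise p Cs s t)) u = - Cs s t (dual_act p act X u)" for X s t u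
    by (simp only: dact rai[symmetric] minus_minus)
  have w1: "lower p C r s = lower p C s r" for r s
    by (simp only: lower_def sC(1)[of r s])
  have w2: "Cs (lower p C r s) t u = Cs t (lower p C r s) u" for r s t u
    by (rule sCs(1))
  have w3: "Cs t (lower p C r s) u = C (raise p Cs u t) r s" for r s t u
  proof -
    have "raise p Cs t u = raise p Cs u t" by (simp only: raise_def sCs(1)[of t u])
    then show ?thesis by (simp only: c1) (metis sC)
  qed
  have i1: "C r s (act X u) = - C (act X r) s u - C r (act X s) u" for X r s u
    using iC[unfolded invariant_cubic_def, rule_format, of X r s u] by (rule add3_eq_0)
  have i2: "Cs r s (dual_act p act X u) = - Cs (dual_act p act X r) s u - Cs r (dual_act p act X s) u" for X r s u
    using iCs[unfolded invariant_cubic_def, rule_format, of X r s u] by (rule add3_eq_0)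
  obtain X a t t' where x: "x = (X, a, t, t')" by (cases x)
  obtain Y b s s' where y: "y = (Y, b, s, s')" by (cases y)
  obtain \<alpha> r q \<beta> where v: "v = (\<alpha>, r, q, \<beta>)" by (cases v)
  note L = clinearD[OF la(1)] clinearD[OF la(2)] clinearD[OF lp(1)] clinearD[OF lp(2)]
    clinearD[OF lC] clinearD[OF lCs] clinearD[OF lC'(1)] clinearD[OF lC'(2)] 
    clinearD[OF lCs'(1)] clinearD[OF lCs'(2)]
  show ?thesis
    unfolding x y v


    apply (simp add: scaleC_prod_def  prod_eq_iff)
    apply (intro conjI)


    subgoal by (simp only: L low rai dact br scaleC_complex_def) (simp add: field_simps sCs(2)[of q t' s'])
    subgoal
      apply (rule eqw)
      apply (simp only: L low rai dact br th c3 scaleC_complex_def)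
      apply (simp only: i2[of q s' X] i2[of q t' Y] w1[of t r] w1[of s r] w2 sCs(1)[of s' t'])
      apply (simp add: field_simps)
      done
    subgoal
      apply (rule eqd)
      apply (simp only: L low rai dact br th scaleC_complex_def)
      apply (simp only: i1[of r s X] i1[of r t Y] w3 sC(1)[of s t])
      apply (simp add: field_simps)
      done
    subgoal by (simp only: L low rai dact br scaleC_complex_def) (simp add: field_simps sC(2)[of r t s])
    done
qed

fun freudenthal_quartic ::
  "('w \<Rightarrow> 'd \<Rightarrow> complex) \<Rightarrow> ('w \<Rightarrow> 'w \<Rightarrow> 'w \<Rightarrow> complex) \<Rightarrow> ('d \<Rightarrow> 'd \<Rightarrow> 'd \<Rightarrow> complex) \<Rightarrow>
   ('w, 'd) V \<Rightarrow> complex"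
  where "freudenthal_quartic p C Cs (\<alpha>, r, s, \<beta>) =
    (3 * \<alpha> * \<beta> - 1/2 * p r s)^2
    + 1/3 * (\<beta> * C r r r + \<alpha> * Cs s s s)
    - 1/6 * p (raise p Cs s s) (lower p C r r)"

end

theory Submission
  imports Defs
begin

text \<open>
  There are two things to see: \<open>Q\<close> is a polynomial of degree four, and its derivative at \<open>v\<close>
  in the direction \<open>x . v\<close> vanishes for every \<open>x\<close> in \<open>\<gg> = \<hh> \<oplus> \<complex> \<oplus> W \<oplus> W*\<close>.

  The first is where finite dimensionality enters. The pairing and the two cubics are only given
  as multilinear maps on abstract spaces; expanding one argument at a time in coordinates turns
  them into sums of products of linear functionals (\<open>form_substitute\<close>). A finite basis of \<open>W\<close>
  comes from the list of the five pairs, and the perfect pairing carries it over to \<open>W*\<close>.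

  For the second, the derivative is linear in the direction, so the four summands of \<open>\<gg>\<close> can be
  treated separately. For \<open>\<hh>\<close> it vanishes because all the ingredients of \<open>Q\<close> are
  \<open>\<hh>\<close>-invariant, and for \<open>\<complex>\<close> because every monomial of \<open>Q\<close> has total weight zero. For
  \<open>t \<in> W\<close> everything cancels except three terms, and these cancel exactly when
  \<open>\<langle>C*(s C(rt)), C(r\<^sup>2)\<rangle> = 3/2 \<langle>r,s\<rangle> C(r\<^sup>2t) + 1/2 \<langle>t,s\<rangle> C(r\<^sup>3)\<close>.
  This identity (\<open>adjoint_identity\<close>) is the infinitesimal invariance of \<open>C\<close> under the single
  element \<open>\<theta>(r \<otimes> s)\<close> of \<open>\<hh>\<close>, evaluated at \<open>(r, r, t)\<close>: the normalization writes
  \<open>\<theta>(r \<otimes> s)\<close> in terms of \<open>C\<close>, \<open>C*\<close> and the pairing, and each of the three terms of the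
  Leibniz rule contributes the left-hand side once. The case of \<open>W*\<close> is the dual statement,
  obtained from the invariance of \<open>C*\<close> under the same element.
\<close>

section \<open>Polynomial forms on finite-dimensional spaces\<close>

lemma clinearI:
  assumes "\<And>x y. f (x + y) = f x + f y" and "\<And>a x. f (a *C x) = a *C f x"
  shows "clinear f"
  using assms by unfold_locales auto

lemma clinear_compose: "clinear f \<Longrightarrow> clinear g \<Longrightarrow> clinear (\<lambda>x. g (f x))"
  by (rule clinearI) (simp_all add: clinearD)

lemma clinear_sum: "clinear f \<Longrightarrow> f (sum g I) = (\<Sum>i\<in>I. f (g i))"
  by (induction I rule: infinite_finite_induct) (simp_all add: clinearD)

lemma clinear_fst: "clinear fst"
  by (auto intro!: clinearI simp: scaleC_prod_def)

lemma form_scale: "form k P \<Longrightarrow> form k (\<lambda>v. c * P v)"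
  using form.mult[OF form.const, of k P c] by simp

text \<open>
  The degree-\<open>k\<close> zero form is needed because an empty sum of forms must still have degree \<open>k\<close>.
\<close>

lemma form_zero: "form k (\<lambda>_. 0)"
proof (induction k)
  case 0
  show ?case by (rule form.const)
next
  case (Suc k)
  from form.mult[OF form.linear[of "\<lambda>_. 0"] this] show ?case
    by (simp add: clinearI)
qed

lemma form_sum:
  "(\<And>i. i \<in> I \<Longrightarrow> form k (P i)) \<Longrightarrow> form k (\<lambda>v. \<Sum>i\<in>I. P i v)"
  by (induction I rule: infinite_finite_induct) (auto intro: form_zero form.add)

text \<open>
  Coordinates on a finite-dimensional space: the vectors \<open>e i\<close> span and the functionals \<open>c i\<close>
  give the coefficients. The index set is kept abstract so that the dual family on \<open>W*\<close> can be
  indexed by the same set.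
\<close>

definition coordinates ::
  "'i set \<Rightarrow> ('i \<Rightarrow> 'w::complex_vector) \<Rightarrow> ('i \<Rightarrow> 'w \<Rightarrow> complex) \<Rightarrow> bool"
  where "coordinates I e c \<longleftrightarrow> (\<forall>i\<in>I. clinear (c i)) \<and> (\<forall>w. w = (\<Sum>i\<in>I. c i w *C e i))"

text \<open>
  If \<open>G\<close> is linear in a vector parameter, then \<open>G (l v) v\<close> is the sum of the products
  \<open>c i (l v) * G (e i) v\<close> of a linear form and a form of degree \<open>k\<close>. Applied repeatedly, this
  turns a multilinear map into a form by freeing one argument after the other.
\<close>

lemma form_substitute:
  fixes l :: "'v::complex_vector \<Rightarrow> 'w::complex_vector"
    and G :: "'w \<Rightarrow> 'v \<Rightarrow> complex" and c :: "'i \<Rightarrow> 'w \<Rightarrow> complex"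
  assumes crd: "coordinates I e c" and l: "clinear l"
    and lin: "\<And>v. clinear (\<lambda>w. G w v)" and G: "\<And>w. form k (G w)"
  shows "form (Suc k) (\<lambda>v. G (l v) v)"
proof -
  have "G (l v) v = (\<Sum>i\<in>I. c i (l v) * G (e i) v)" for v
  proof -
    have "G (l v) v = G (\<Sum>i\<in>I. c i (l v) *C e i) v"
      using crd unfolding coordinates_def by metis
    then show ?thesis
      by (simp only: clinear_sum[OF lin] clinearD(2)[OF lin] scaleC_complex_def)
  qed
  then have eq: "(\<lambda>v. G (l v) v) = (\<lambda>v. \<Sum>i\<in>I. c i (l v) * G (e i) v)"
    by (rule ext)
  have "form (1 + k) (\<lambda>v. \<Sum>i\<in>I. c i (l v) * G (e i) v)"
    using crd l
    by (intro form_sum form.mult G form.linear) (auto simp: coordinates_def intro: clinear_compose)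
  then show ?thesis
    by (simp only: eq plus_1_eq_Suc)
qed

lemma finite_basis_coordinates:
  fixes B :: "'w::complex_vector set"
  assumes "finite B" and "cvs.independent B" and "cvs.span B = UNIV"
  shows "coordinates B (\<lambda>b. b) (\<lambda>b w. cvs.representation B w b)"
  unfolding coordinates_def
proof (intro conjI ballI allI)
  show "clinear (\<lambda>w. cvs.representation B w b)" for b
    using assms
    by (intro clinearI) (simp_all add: cvs.representation_add cvs.representation_scale)
  show "w = (\<Sum>b\<in>B. cvs.representation B w b *C b)" for w
    using cvs.sum_representation_eq[of B w B] assms by simp
qed

section \<open>Finite dimensionality of the five modules\<close>

lemma matrix_span: "\<exists>S :: (complex^'n^'m) set. finite S \<and> cvs.span S = UNIV"
proof (intro exI conjI)
  let ?E = "\<lambda>(i::'m, j::'n). axis i (axis j (1::complex))"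
  show "finite (range ?E)" by simp
  have "M \<in> cvs.span (range ?E)" for M :: "complex^'n^'m"
  proof -
    have "(\<Sum>ij\<in>UNIV. (M $ fst ij $ snd ij) *C ?E ij) $ k $ l = M $ k $ l" for k l
    proof -
      have "(\<Sum>ij\<in>UNIV. (M $ fst ij $ snd ij) *C ?E ij) $ k $ l
          = (\<Sum>ij\<in>UNIV. if ij = (k, l) then M $ k $ l else 0)"
        unfolding sum_component
        by (rule sum.cong) (simp_all add: scaleC_vec_def axis_def split: prod.splits)
      then show ?thesis by simp
    qed
    then have "M = (\<Sum>ij\<in>UNIV. (M $ fst ij $ snd ij) *C ?E ij)"
      by (simp add: vec_eq_iff)
    also have "\<dots> \<in> cvs.span (range ?E)"
      by (intro cvs.span_sum cvs.span_scale cvs.span_base rangeI)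
    finally show ?thesis .
  qed
  then show "cvs.span (range ?E) = UNIV"
    by blast
qed

lemma complex_span: "\<exists>S :: complex set. finite S \<and> cvs.span S = UNIV"
proof (intro exI conjI)
  have "z *C 1 \<in> cvs.span {1::complex}" for z
    by (intro cvs.span_scale cvs.span_base) simp
  then show "cvs.span {1::complex} = UNIV" by auto
qed simp

lemma basis_exists:
  obtains B :: "'w::complex_vector set" where "cvs.independent B" "cvs.span B = UNIV"
  using that[of "cvs.extend_basis {}"]
  by (simp add: cvs.independent_extend_basis cvs.span_extend_basis cvs.independent_empty)

text \<open>
  An injective linear map sends a basis to an independent set, which is finite when the target is
  finite-dimensional. Four of the five pairs are given by such an embedding into a space of
  numbers or matrices.
\<close>

lemma finite_basis_if_embeds:
  fixes \<psi> :: "'w::complex_vector \<Rightarrow> 'b::complex_vector"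
  assumes \<psi>: "clinear \<psi>" "inj \<psi>" and S: "\<exists>S :: 'b set. finite S \<and> cvs.span S = UNIV"
  shows "\<exists>B :: 'w set. finite B \<and> cvs.independent B \<and> cvs.span B = UNIV"
proof -
  interpret \<psi>: Vector_Spaces.linear scaleC scaleC \<psi> by (fact \<psi>)
  obtain B :: "'w set" where B: "cvs.independent B" "cvs.span B = UNIV"
    by (rule basis_exists)
  have inj: "inj_on \<psi> X" for X
    using \<psi>(2) by (rule inj_on_subset) simp
  have "cvs.independent (\<psi> ` B)"
    using B inj by (intro \<psi>.independent_injective_image) auto
  then have "finite (\<psi> ` B)"
    using S cvs.independent_span_bound[of _ "\<psi> ` B"] by auto
  then have "finite B"
    using inj by (rule finite_imageD)
  with B show ?thesis by blast
qed

lemma pair_iso_embeds: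
  fixes act :: "'h::complex_vector \<Rightarrow> 'w::complex_vector \<Rightarrow> 'w" and W :: "'b::complex_vector set"
  assumes "pair_iso br act H brM W actM"
  obtains \<psi> :: "'w \<Rightarrow> 'b" where "clinear \<psi>" "inj \<psi>"
proof -
  from assms obtain \<psi> :: "'w \<Rightarrow> 'b" where "clinear \<psi>" "bij_betw \<psi> UNIV W"
    unfolding pair_iso_def by (elim exE conjE)
  then show thesis
    by (intro that[of \<psi>] bij_betw_imp_inj_on)
qed

text \<open>
  For the fifth pair finiteness can be read off from the dimension 27, since the dimension of a
  space without a finite basis is zero by convention.
\<close>

lemma freudenthal_pair_finite_basis:
  fixes act :: "'h::complex_vector \<Rightarrow> 'w::complex_vector \<Rightarrow> 'w"
  assumes "freudenthal_pair br act"
  shows "\<exists>B :: 'w set. finite B \<and> cvs.independent B \<and> cvs.span B = UNIV"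
  using assms unfolding freudenthal_pair_def
proof (elim conjE disjE)
  assume dim: "cvs.dim (UNIV :: 'w set) = 27"
  obtain B :: "'w set" where B: "cvs.independent B" "cvs.span B = UNIV"
    by (rule basis_exists)
  then have "card B = 27"
    using dim cvs.dim_eq_card[of B UNIV] by simp
  then have "finite B"
    by (simp add: card_ge_0_finite)
  with B show ?thesis by blast
qed (erule pair_iso_embeds, erule (1) finite_basis_if_embeds, rule complex_span matrix_span)+

section \<open>Dual cubic forms\<close>

text \<open>
  Elements of \<open>W\<close> and \<open>W*\<close> are compared by pairing them with all elements of the other space;
  this reduces every identity between \<open>lower\<close> and \<open>raise\<close> expressions to one between numbers.
\<close>

locale dual_cubics =
  fixes p :: "'w::complex_vector \<Rightarrow> 'd::complex_vector \<Rightarrow> complex"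
    and C :: "'w \<Rightarrow> 'w \<Rightarrow> 'w \<Rightarrow> complex"
    and Cs :: "'d \<Rightarrow> 'd \<Rightarrow> 'd \<Rightarrow> complex"
  assumes pairing: "perfect_pairing p"
    and C: "symmetric_trilinear C"
    and Cs: "symmetric_trilinear Cs"
begin

lemma clinear_p: "clinear (p w)" "clinear (\<lambda>w. p w d)"
  using pairing by (auto simp: perfect_pairing_def cbilinear_def)

lemma functional_W: "clinear l \<Longrightarrow> \<exists>!d. \<forall>w. p w d = l w"
  and functional_dual: "clinear l' \<Longrightarrow> \<exists>!w. \<forall>d. p w d = l' d"
  using pairing by (auto simp: perfect_pairing_def)

lemma dual_eqI: "(\<And>w. p w d = p w d') \<Longrightarrow> d = d'"
  using functional_W[OF clinear_p(2)[of d]] by metis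

lemma W_eqI: "(\<And>d. p w d = p w' d) \<Longrightarrow> w = w'"
  using functional_dual[OF clinear_p(1)[of w]] by metis

lemma C_sym: "C r s u = C s r u" "C r s u = C r u s"
  using C by (simp_all add: symmetric_trilinear_def)

lemma Cs_sym: "Cs r s u = Cs s r u" "Cs r s u = Cs r u s"
  using Cs by (simp_all add: symmetric_trilinear_def)

lemma clinear_C: "clinear (C r s)" "clinear (\<lambda>s. C r s u)" "clinear (\<lambda>r. C r s u)"
proof -
  show *: "clinear (C r s)" for r s using C by (simp add: symmetric_trilinear_def)
  show "clinear (\<lambda>s. C r s u)" for r using *[of r u] by (simp only: C_sym(2)[of r _ u])
  from this[of s] show "clinear (\<lambda>r. C r s u)" by (simp only: C_sym(1)[of _ s u])
qed

lemma clinear_Cs: "clinear (Cs r s)" "clinear (\<lambda>s. Cs r s u)" "clinear (\<lambda>r. Cs r s u)"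
proof -
  show *: "clinear (Cs r s)" for r s using Cs by (simp add: symmetric_trilinear_def)
  show "clinear (\<lambda>s. Cs r s u)" for r using *[of r u] by (simp only: Cs_sym(2)[of r _ u])
  from this[of s] show "clinear (\<lambda>r. Cs r s u)" by (simp only: Cs_sym(1)[of _ s u])
qed

lemma p_lower: "p u (lower p C r s) = C r s u"
  using theI'[OF functional_W[OF clinear_C(1)[of r s]]] by (simp add: lower_def)

lemma p_raise: "p (raise p Cs r s) u = Cs r s u"
  using theI'[OF functional_dual[OF clinear_Cs(1)[of r s]]] by (simp add: raise_def)

lemma raise_commute: "raise p Cs r s = raise p Cs s r"
  by (rule W_eqI) (simp add: p_raise Cs_sym(1)[of r])

text \<open>
  Both sides are \<open>\<langle>C*(tu), C(rs)\<rangle>\<close>. This adjunction is used to bring all mixed expressions to the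
  form with \<open>C\<close> outermost.
\<close>

lemma Cs_lower: "Cs t u (lower p C r s) = C r s (raise p Cs t u)"
  by (simp only: p_lower[symmetric] p_raise)

lemmas multilinear = clinearD[OF clinear_p(1)] clinearD[OF clinear_p(2)]
  clinearD[OF clinear_C(1)] clinearD[OF clinear_C(2)] clinearD[OF clinear_C(3)]
  clinearD[OF clinear_Cs(1)] clinearD[OF clinear_Cs(2)] clinearD[OF clinear_Cs(3)]

lemma raise_add: "raise p Cs (s + s') t = raise p Cs s t + raise p Cs s' t"
  by (rule W_eqI) (simp add: p_raise multilinear)

lemma raise_scale: "raise p Cs (a *C s) t = a *C raise p Cs s t"
  by (rule W_eqI) (simp add: p_raise multilinear)

lemma raise_add': "raise p Cs s (t + t') = raise p Cs s t + raise p Cs s t'"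
  by (rule W_eqI) (simp add: p_raise multilinear)

lemma raise_scale': "raise p Cs s (a *C t) = a *C raise p Cs s t"
  by (rule W_eqI) (simp add: p_raise multilinear)

lemma clinear_raise: "clinear (raise p Cs s)" "clinear (\<lambda>s. raise p Cs s t)"
  by (auto intro!: clinearI simp: raise_add raise_scale raise_add' raise_scale')

text \<open>
  The dual family: \<open>e' i\<close> is the element of \<open>W*\<close> representing the functional \<open>c i\<close>, and the
  coefficient of \<open>e' i\<close> in \<open>d\<close> is the value of \<open>d\<close> at \<open>e i\<close>.
\<close>

lemma dual_coordinates:
  assumes "coordinates I e c"
  shows "\<exists>e'. coordinates I e' (\<lambda>i d. p (e i) d)"
proof -
  have c: "clinear (c i)" if "i \<in> I" for i
    using assms that by (simp add: coordinates_def)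
  have e: "w = (\<Sum>i\<in>I. c i w *C e i)" for w
    using assms by (simp add: coordinates_def)
  have "\<exists>d. \<forall>w. p w d = c i w" if "i \<in> I" for i
    using functional_W[OF c[OF that]] by blast
  then obtain e' where e': "p w (e' i) = c i w" if "i \<in> I" for i w
    by metis
  have "d = (\<Sum>i\<in>I. p (e i) d *C e' i)" for d
  proof (rule dual_eqI)
    fix w
    have "p w d = p (\<Sum>i\<in>I. c i w *C e i) d"
      using e[of w] by simp
    also have "\<dots> = (\<Sum>i\<in>I. c i w * p (e i) d)"
      by (simp only: clinear_sum[OF clinear_p(2)] multilinear scaleC_complex_def)
    also have "\<dots> = p w (\<Sum>i\<in>I. p (e i) d *C e' i)"
      by (simp add: clinear_sum[OF clinear_p(1)] multilinear e' mult.commute)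
    finally show "p w d = p w (\<Sum>i\<in>I. p (e i) d *C e' i)" .
  qed
  then show ?thesis
    using clinear_p(1) by (auto simp: coordinates_def)
qed

text \<open>
  Each of the four building blocks of \<open>Q\<close> starts from a functional that is linear in one argument
  while the others are frozen; \<open>form_substitute\<close> then frees the frozen arguments.
\<close>

lemma form_freudenthal_quartic:
  fixes e :: "'i \<Rightarrow> 'w"
  assumes W: "coordinates I e c"
  shows "form 4 (freudenthal_quartic p C Cs)"
proof -
  obtain e' where D: "coordinates I e' (\<lambda>i d. p (e i) d)"
    using dual_coordinates[OF W] by blast
  define R :: "('w, 'd) V \<Rightarrow> 'w" where "R v = fst (snd v)" for v
  define S :: "('w, 'd) V \<Rightarrow> 'd" where "S v = fst (snd (snd v))" for v
  define b :: "('w, 'd) V \<Rightarrow> complex" where "b v = snd (snd (snd v))" for v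
  have R: "clinear R" and S: "clinear S" and b: "clinear b"
    unfolding R_def S_def b_def by (auto intro!: clinearI simp: scaleC_prod_def)
  have a1: "form 1 (fst :: ('w, 'd) V \<Rightarrow> complex)" and b1: "form 1 b"
    by (rule form.linear, fact clinear_fst b)+
  \<comment> \<open>the projections of \<open>V\<close> onto \<open>W\<close> and \<open>W*\<close> are substituted for the frozen arguments\<close>
  note substW = form_substitute[OF W R] and substD = form_substitute[OF D S]
  have pairing_form: "form 2 (\<lambda>v. p (R v) (S v))"
  proof -
    have "form (Suc 1) (\<lambda>v. p (R v) (S v))"
      by (rule substW, rule clinear_p, rule form.linear, rule clinear_compose[OF S clinear_p(1)])
    then show ?thesis by (simp add: numeral_2_eq_2)
  qed
  have cubic_form: "form 3 (\<lambda>v. C (R v) (R v) (R v))"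
  proof -
    have "form (Suc (Suc 1)) (\<lambda>v. C (R v) (R v) (R v))"
      by (rule substW, rule clinear_C, rule substW, rule clinear_C,
          rule form.linear, rule clinear_compose[OF R clinear_C(1)])
    then show ?thesis by (simp add: numeral_3_eq_3)
  qed
  have dual_cubic_form: "form 3 (\<lambda>v. Cs (S v) (S v) (S v))"
  proof -
    have "form (Suc (Suc 1)) (\<lambda>v. Cs (S v) (S v) (S v))"
      by (rule substD, rule clinear_Cs, rule substD, rule clinear_Cs,
          rule form.linear, rule clinear_compose[OF S clinear_Cs(1)])
    then show ?thesis by (simp add: numeral_3_eq_3)
  qed
  have mixed_form: "form 4 (\<lambda>v. C (R v) (R v) (raise p Cs (S v) (S v)))"
  proof -
    have "form (Suc (Suc (Suc 1))) (\<lambda>v. C (R v) (R v) (raise p Cs (S v) (S v)))"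
      by (rule substW, rule clinear_C, rule substW, rule clinear_C,
          rule substD, rule clinear_compose[OF clinear_raise(2) clinear_C(1)],
          rule form.linear, rule clinear_compose[OF clinear_compose[OF S clinear_raise(1)] clinear_C(1)])
    then show ?thesis by (simp add: eval_nat_numeral)
  qed
  have ab: "form 2 (\<lambda>v. 3 * fst v * b v)"
    using form.mult[OF form_scale[OF a1, of 3] b1] by (simp add: numeral_2_eq_2)
  have sq: "form 2 (\<lambda>v. 3 * fst v * b v + - (1/2) * p (R v) (S v))"
    by (intro form.add ab form_scale pairing_form)
  have "form 4 (\<lambda>v. ((3 * fst v * b v + - (1/2) * p (R v) (S v))
        * (3 * fst v * b v + - (1/2) * p (R v) (S v))
      + 1/3 * (b v * C (R v) (R v) (R v) + fst v * Cs (S v) (S v) (S v)))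
      + - (1/6) * C (R v) (R v) (raise p Cs (S v) (S v)))"
    using form.mult[OF sq sq] form.mult[OF b1 cubic_form] form.mult[OF a1 dual_cubic_form]
    by (intro form.add form_scale mixed_form) simp_all
  also have "(\<lambda>v. ((3 * fst v * b v + - (1/2) * p (R v) (S v))
        * (3 * fst v * b v + - (1/2) * p (R v) (S v))
      + 1/3 * (b v * C (R v) (R v) (R v) + fst v * Cs (S v) (S v) (S v)))
      + - (1/6) * C (R v) (R v) (raise p Cs (S v) (S v))) = freudenthal_quartic p C Cs"
    by (auto simp: R_def S_def b_def p_lower power2_eq_square)
  finally show ?thesis .
qed

section \<open>The differential of the quartic\<close>

text \<open>
  The differential of \<open>Q\<close> at its first argument, applied to the second. The last term of \<open>Q\<close> is
  differentiated in the form \<open>C(r, r, C*(s\<^sup>2))\<close>.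
\<close>

fun quartic_differential :: "('w, 'd) V \<Rightarrow> ('w, 'd) V \<Rightarrow> complex"
  where "quartic_differential (\<alpha>, r, s, \<beta>) (a, \<rho>, \<sigma>, b) =
    2 * (3 * \<alpha> * \<beta> - 1/2 * p r s)
      * (3 * a * \<beta> + 3 * \<alpha> * b - 1/2 * p \<rho> s - 1/2 * p r \<sigma>)
    + 1/3 * (b * C r r r + 3 * \<beta> * C r r \<rho> + a * Cs s s s + 3 * \<alpha> * Cs s s \<sigma>)
    - 1/3 * (C r \<rho> (raise p Cs s s) + C r r (raise p Cs s \<sigma>))"

lemma clinear_quartic_differential: "clinear (quartic_differential v)"
proof (cases v)
  case (fields \<alpha> r s \<beta>)
  show ?thesis
  proof (rule clinearI)
    show "quartic_differential v (x + y) = quartic_differential v x + quartic_differential v y" for x y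
      unfolding fields
      by (cases x; cases y)
        (simp only: quartic_differential.simps add_Pair multilinear raise_add',
          simp add: field_simps)
    show "quartic_differential v (z *C x) = z *C quartic_differential v x" for z x
      unfolding fields
      by (cases x)
        (simp only: quartic_differential.simps scaleC_prod_def fst_conv snd_conv multilinear
            raise_scale' scaleC_complex_def, simp add: field_simps)
  qed
qed

text \<open>
  Along the line \<open>\<epsilon> \<mapsto> v + \<epsilon> u\<close> each ingredient of \<open>Q\<close> is a polynomial in \<open>\<epsilon>\<close>,
  obtained by expanding a multilinear map, and only its coefficients of degree zero and one
  enter the derivative at zero.
\<close>

lemma induced_derivation_quartic:
  "induced_derivation A (freudenthal_quartic p C Cs) v = - quartic_differential v (A v)"
proof -
  obtain \<alpha> r s \<beta> where v: "v = (\<alpha>, r, s, \<beta>)" by (cases v)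
  obtain a \<rho> \<sigma> b where u: "A v = (a, \<rho>, \<sigma>, b)" by (cases "A v")
  have C_swap: "C r \<rho> r = C r r \<rho>" "C \<rho> r r = C r r \<rho>" "C \<rho> r x = C r \<rho> x"
    "C \<rho> r \<rho> = C r \<rho> \<rho>" "C \<rho> \<rho> r = C r \<rho> \<rho>" for x
    using C_sym by metis+
  have Cs_swap: "Cs s \<sigma> s = Cs s s \<sigma>" "Cs \<sigma> s s = Cs s s \<sigma>"
    "Cs \<sigma> s x = Cs s \<sigma> x" "Cs \<sigma> s \<sigma> = Cs s \<sigma> \<sigma>" "Cs \<sigma> \<sigma> s = Cs s \<sigma> \<sigma>" for x
    using Cs_sym by metis+
  define P where "P \<epsilon> = 3 * (\<alpha> + \<epsilon> * a) * (\<beta> + \<epsilon> * b)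
    - 1/2 * (p r s + \<epsilon> * (p \<rho> s + p r \<sigma>) + \<epsilon>^2 * p \<rho> \<sigma>)" for \<epsilon>
  define c where "c \<epsilon> = C r r r + 3 * \<epsilon> * C r r \<rho> + 3 * \<epsilon>^2 * C r \<rho> \<rho> + \<epsilon>^3 * C \<rho> \<rho> \<rho>" for \<epsilon>
  define cs where
    "cs \<epsilon> = Cs s s s + 3 * \<epsilon> * Cs s s \<sigma> + 3 * \<epsilon>^2 * Cs s \<sigma> \<sigma> + \<epsilon>^3 * Cs \<sigma> \<sigma> \<sigma>" for \<epsilon>
  define m where "m x \<epsilon> = C r r x + 2 * \<epsilon> * C r \<rho> x + \<epsilon>^2 * C \<rho> \<rho> x" for x \<epsilon>
  have c: "C (r + \<epsilon> *C \<rho>) (r + \<epsilon> *C \<rho>) (r + \<epsilon> *C \<rho>) = c \<epsilon>" for \<epsilon>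
    by (simp add: c_def multilinear C_swap algebra_simps power2_eq_square power3_eq_cube)
  have cs: "Cs (s + \<epsilon> *C \<sigma>) (s + \<epsilon> *C \<sigma>) (s + \<epsilon> *C \<sigma>) = cs \<epsilon>" for \<epsilon>
    by (simp add: cs_def multilinear Cs_swap algebra_simps power2_eq_square power3_eq_cube)
  have m: "C (r + \<epsilon> *C \<rho>) (r + \<epsilon> *C \<rho>) x = m x \<epsilon>" for x \<epsilon>
    by (simp add: m_def multilinear C_swap algebra_simps power2_eq_square)
  have ms: "raise p Cs (s + \<epsilon> *C \<sigma>) (s + \<epsilon> *C \<sigma>)
      = raise p Cs s s + (2 * \<epsilon>) *C raise p Cs s \<sigma> + \<epsilon>^2 *C raise p Cs \<sigma> \<sigma>" for \<epsilon>
    by (rule W_eqI)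
      (simp add: multilinear p_raise Cs_swap algebra_simps power2_eq_square)
  have P: "3 * (\<alpha> + \<epsilon> * a) * (\<beta> + \<epsilon> * b) - 1/2 * p (r + \<epsilon> *C \<rho>) (s + \<epsilon> *C \<sigma>) = P \<epsilon>" for \<epsilon>
    by (simp add: P_def multilinear algebra_simps power2_eq_square)
  have "freudenthal_quartic p C Cs (v + \<epsilon> *C A v)
      = (P \<epsilon>)^2 + 1/3 * ((\<beta> + \<epsilon> * b) * c \<epsilon> + (\<alpha> + \<epsilon> * a) * cs \<epsilon>)
        - 1/6 * (m (raise p Cs s s) \<epsilon> + 2 * \<epsilon> * m (raise p Cs s \<sigma>) \<epsilon>
          + \<epsilon>^2 * m (raise p Cs \<sigma> \<sigma>) \<epsilon>)" for \<epsilon>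
  proof -
    have "v + \<epsilon> *C A v = (\<alpha> + \<epsilon> * a, r + \<epsilon> *C \<rho>, s + \<epsilon> *C \<sigma>, \<beta> + \<epsilon> * b)"
      unfolding u by (simp add: v scaleC_prod_def)
    then show ?thesis
      by (simp only: freudenthal_quartic.simps P c cs p_lower ms)
        (simp only: clinearD(1,2)[OF clinear_C(1)] scaleC_complex_def m)
  qed
  moreover have "((\<lambda>\<epsilon>. (P \<epsilon>)^2 + 1/3 * ((\<beta> + \<epsilon> * b) * c \<epsilon> + (\<alpha> + \<epsilon> * a) * cs \<epsilon>)
        - 1/6 * (m (raise p Cs s s) \<epsilon> + 2 * \<epsilon> * m (raise p Cs s \<sigma>) \<epsilon>
          + \<epsilon>^2 * m (raise p Cs \<sigma> \<sigma>) \<epsilon>))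
      has_field_derivative quartic_differential v (A v)) (at 0)"
    unfolding u unfolding v P_def c_def cs_def m_def
    by (rule derivative_eq_intros refl)+ (simp add: field_simps)
  ultimately have "((\<lambda>\<epsilon>. freudenthal_quartic p C Cs (v + \<epsilon> *C A v)) has_field_derivative
      quartic_differential v (A v)) (at 0)"
    by simp
  then show ?thesis
    by (simp add: induced_derivation_def DERIV_imp_deriv)
qed

text \<open>
  The weights \<open>-3/2, -1/2, 1/2, 3/2\<close> of \<open>\<alpha>, r, s, \<beta>\<close> add up to zero on each of the monomials
  \<open>\<alpha>\<beta>\<close>, \<open>\<langle>r,s\<rangle>\<close>, \<open>\<beta> C(r\<^sup>3)\<close>, \<open>\<alpha> C*(s\<^sup>3)\<close> and \<open>\<langle>C*(s\<^sup>2), C(r\<^sup>2)\<rangle>\<close>.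
\<close>

lemma quartic_differential_grading:
  "quartic_differential (\<alpha>, r, s, \<beta>) (- (3/2) * \<alpha>, (- (1/2)) *C r, (1/2) *C s, 3/2 * \<beta>) = 0"
  by (simp add: multilinear raise_scale' algebra_simps)

end

section \<open>Invariance\<close>

locale normalized_cubics = dual_cubics p C Cs
  for p :: "'w::complex_vector \<Rightarrow> 'd::complex_vector \<Rightarrow> complex"
    and C :: "'w \<Rightarrow> 'w \<Rightarrow> 'w \<Rightarrow> complex"
    and Cs :: "'d \<Rightarrow> 'd \<Rightarrow> 'd \<Rightarrow> complex" +
  fixes act :: "'h::complex_vector \<Rightarrow> 'w \<Rightarrow> 'w"
    and th :: "'w \<Rightarrow> 'd \<Rightarrow> 'h"
  assumes clinear_act: "clinear (act X)"
    and C_invariant: "invariant_cubic act C"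
    and Cs_invariant: "invariant_cubic (dual_act p act) Cs"
    and normalized: "normalized act p C Cs th"
begin

lemma p_dual_act: "p w (dual_act p act X d) = - p (act X w) d"
proof -
  have "clinear (\<lambda>w. - p (act X w) d)"
    by (rule clinearI) (simp_all add: clinearD[OF clinear_act] multilinear)
  then show ?thesis
    using theI'[OF functional_W[of "\<lambda>w. - p (act X w) d"]] by (simp add: dual_act_def)
qed

lemma C_act: "C (act X r) s u + C r (act X s) u + C r s (act X u) = 0"
  using C_invariant by (simp add: invariant_cubic_def)

lemma Cs_act: "Cs (dual_act p act X r) s u + Cs r (dual_act p act X s) u
    + Cs r s (dual_act p act X u) = 0"
  using Cs_invariant by (simp add: invariant_cubic_def)

text \<open>
  The invariance of \<open>C*\<close>, read as equivariance of the product \<open>C* : W* \<times> W* \<rightarrow> W\<close>.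
\<close>

lemma act_raise:
  "act X (raise p Cs s t) = raise p Cs (dual_act p act X s) t + raise p Cs s (dual_act p act X t)"
proof (rule W_eqI)
  fix d
  have "p (act X (raise p Cs s t)) d = - Cs s t (dual_act p act X d)"
    using p_dual_act[of "raise p Cs s t" X d] by (simp add: p_raise)
  also have "\<dots> = Cs (dual_act p act X s) t d + Cs s (dual_act p act X t) d"
    using Cs_act[of X s t d] by (simp add: algebra_simps add_eq_0_iff)
  finally show "p (act X (raise p Cs s t)) d
      = p (raise p Cs (dual_act p act X s) t + raise p Cs s (dual_act p act X t)) d"
    by (simp add: multilinear p_raise)
qed

text \<open>
  Adding the two normalization identities isolates \<open>2 \<theta>(r \<otimes> t) s\<close>: the antisymmetric one
  contributes \<open>\<plusminus>1\<close> and the symmetric one \<open>2\<close>, hence the coefficients \<open>(2 \<plusminus> 1)/2\<close>.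
\<close>

lemma act_th:
  "act (th r t) s = (1/2 * p r t) *C s + (3/2 * p s t) *C r - raise p Cs t (lower p C r s)"
proof (rule W_eqI)
  fix d
  have 1: "p (act (th r t) s - act (th s t) r) d = p (p s t *C r - p r t *C s) d"
    and 2: "p (act (th r t) s + act (th s t) r) d
      = p (2 *C (p s t *C r + p r t *C s) - 2 *C raise p Cs t (lower p C r s)) d"
    using normalized by (simp_all add: normalized_def)
  have "2 * p (act (th r t) s) d
      = 2 * p ((1/2 * p r t) *C s + (3/2 * p s t) *C r - raise p Cs t (lower p C r s)) d"
    using arg_cong2[OF 1 2, of "(+)"] by (simp add: multilinear algebra_simps)
  then show "p (act (th r t) s) d
      = p ((1/2 * p r t) *C s + (3/2 * p s t) *C r - raise p Cs t (lower p C r s)) d"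
    by simp
qed

text \<open>
  The negative transpose of \<open>act_th\<close>.
\<close>

lemma dual_act_th:
  "dual_act p act (th r t) d
    = lower p C r (raise p Cs t d) - (1/2 * p r t) *C d - (3/2 * p r d) *C t"
proof (rule dual_eqI)
  fix w
  have "Cs t (lower p C r w) d = C r (raise p Cs t d) w"
    by (simp only: Cs_sym(2)[of t "lower p C r w"] Cs_lower C_sym(2)[of r w])
  then show "p w (dual_act p act (th r t) d)
      = p w (lower p C r (raise p Cs t d) - (1/2 * p r t) *C d - (3/2 * p r d) *C t)"
    by (simp add: p_dual_act act_th multilinear p_raise p_lower algebra_simps)
qed

text \<open>
  Linearization of the classical adjoint identity for the cubic norm of a Jordan algebra.
  Differentiating \<open>C(r, r, t)\<close> along \<open>\<theta>(r \<otimes> s)\<close> gives three terms, two of which agree by symmetry.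
  By \<open>act_th\<close> each of them contains \<open>-C(r, r, C*(s C(rt)))\<close>, so the vanishing of their sum
  determines three times this number.
\<close>

lemma adjoint_identity:
  "C r r (raise p Cs s (lower p C r t)) = 3/2 * p r s * C r r t + 1/2 * p t s * C r r r"
proof -
  have swap: "C r (raise p Cs s (lower p C r r)) t = C r r (raise p Cs s (lower p C r t))"
    by (metis C_sym(2) Cs_lower Cs_sym(2))
  have "C (act (th r s) r) r t = C r (act (th r s) r) t"
    by (rule C_sym)
  then have "2 * C r (act (th r s) r) t + C r r (act (th r s) t) = 0"
    using C_act[of "th r s" r r t] by simp
  then have "3 * C r r (raise p Cs s (lower p C r t))
      = 3 * (3/2 * p r s * C r r t + 1/2 * p t s * C r r r)"
    by (simp add: act_th multilinear swap C_sym(2)[of r t r] algebra_simps)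
  then show ?thesis
    by (simp only: mult_cancel_left) simp
qed

text \<open>
  The same argument for \<open>C*(s, s, t)\<close> and the dual action of \<open>\<theta>(r \<otimes> s)\<close>.
\<close>

lemma dual_adjoint_identity:
  "C r (raise p Cs s t) (raise p Cs s s) = 3/2 * p r s * Cs s s t + 1/2 * p r t * Cs s s s"
proof -
  have Cs_low: "Cs s (lower p C r x) t = C r x (raise p Cs s t)" for x
    by (metis Cs_lower Cs_sym(2))
  have swap: "C r (raise p Cs s s) (raise p Cs s t) = C r (raise p Cs s t) (raise p Cs s s)"
    by (rule C_sym)
  have "Cs (dual_act p act (th r s) s) s t = Cs s (dual_act p act (th r s) s) t"
    by (rule Cs_sym)
  then have "2 * Cs s (dual_act p act (th r s) s) t + Cs s s (dual_act p act (th r s) t) = 0"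
    using Cs_act[of "th r s" s s t] by simp
  then have "3 * C r (raise p Cs s t) (raise p Cs s s)
      = 3 * (3/2 * p r s * Cs s s t + 1/2 * p r t * Cs s s s)"
    by (simp add: dual_act_th multilinear Cs_low Cs_lower swap Cs_sym(2)[of s t s] algebra_simps)
  then show ?thesis
    by (simp only: mult_cancel_left) simp
qed

text \<open>
  The only term that does not vanish by itself is that of \<open>\<langle>C*(s\<^sup>2), C(r\<^sup>2)\<rangle> = C(r, r, C*(s\<^sup>2))\<close>; by
  equivariance of \<open>C*\<close> its derivative is the Leibniz sum for \<open>C\<close> at \<open>(r, r, C*(s\<^sup>2))\<close>.
\<close>

lemma quartic_differential_h:
  "quartic_differential (\<alpha>, r, s, \<beta>) (0, act X r, dual_act p act X s, 0) = 0"
proof -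
  have C3: "C r r (act X r) = 0"
    using C_act[of X r r r] by (simp add: C_sym(1)[of "act X r"] C_sym(2)[of r "act X r"])
  have Cs3: "Cs s s (dual_act p act X s) = 0"
    using Cs_act[of X s s s]
    by (simp add: Cs_sym(1)[of "dual_act p act X s"] Cs_sym(2)[of s "dual_act p act X s"])
  have "act X (raise p Cs s s) = 2 *C raise p Cs s (dual_act p act X s)"
    unfolding act_raise raise_commute[of "dual_act p act X s"]
    by (simp add: scaleC_add_left[of 1 1, simplified] scaleC_one)
  then have "2 * (C r (act X r) (raise p Cs s s) + C r r (raise p Cs s (dual_act p act X s)))
      = C (act X r) r (raise p Cs s s) + C r (act X r) (raise p Cs s s)
        + C r r (act X (raise p Cs s s))"
    by (simp add: C_sym(1)[of "act X r" r] multilinear distrib_left)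
  then have "C r (act X r) (raise p Cs s s) + C r r (raise p Cs s (dual_act p act X s)) = 0"
    by (simp only: C_act mult_eq_0_iff) simp
  then show ?thesis
    by (simp add: p_dual_act C3 Cs3)
qed

text \<open>
  The derivative of the bracket \<open>3\<alpha>\<beta> - \<langle>r,s\<rangle>/2\<close> is \<open>-C(r\<^sup>2t)/2\<close>. The terms with a factor \<open>\<alpha>\<close> cancel in
  pairs, and the remaining
  \<open>\<langle>r,s\<rangle>C(r\<^sup>2t)/2 + \<langle>t,s\<rangle>C(r\<^sup>3)/6 - C(r, r, C*(s C(rt)))/3\<close> vanish by the adjoint identity.
\<close>

lemma quartic_differential_W:
  "quartic_differential (\<alpha>, r, s, \<beta>) (0, (3 * \<alpha>) *C t, lower p C r t, 1/2 * p t s) = 0"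
  by (simp add: multilinear p_lower Cs_lower adjoint_identity C_sym(2)[of r t r] algebra_simps)

lemma quartic_differential_dual:
  "quartic_differential (\<alpha>, r, s, \<beta>) (1/2 * p r t, raise p Cs s t, (3 * \<beta>) *C t, 0) = 0"
proof -
  have "C r r (raise p Cs s t) = Cs s t (lower p C r r)"
    by (simp add: Cs_lower)
  then show ?thesis
    by (simp add: multilinear p_raise raise_scale' dual_adjoint_identity Cs_sym(2)[of s t s] algebra_simps)
qed

lemma induced_derivation_quartic_g_act:
  "induced_derivation (g_act act p C Cs x) (freudenthal_quartic p C Cs) v = 0"
proof -
  obtain X z t t' where x: "x = (X, z, t, t')" by (cases x)
  obtain \<alpha> r s \<beta> where v: "v = (\<alpha>, r, s, \<beta>)" by (cases v)
  have "quartic_differential v (g_act act p C Cs x v) = 0"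
    unfolding x v g_act.simps
    by (simp only: clinearD(1,2)[OF clinear_quartic_differential] quartic_differential_h
        quartic_differential_grading quartic_differential_W quartic_differential_dual)
      simp
  then show ?thesis
    by (simp add: induced_derivation_quartic)
qed

end

theorem proposition5p5:
  fixes br :: "'h::complex_vector \<Rightarrow> 'h \<Rightarrow> 'h"
    and act :: "'h \<Rightarrow> 'w::complex_vector \<Rightarrow> 'w"
    and p :: "'w \<Rightarrow> 'd::complex_vector \<Rightarrow> complex"
    and C :: "'w \<Rightarrow> 'w \<Rightarrow> 'w \<Rightarrow> complex"
    and Cs :: "'d \<Rightarrow> 'd \<Rightarrow> 'd \<Rightarrow> complex"
    and th :: "'w \<Rightarrow> 'd \<Rightarrow> 'h"
  assumes "freudenthal_pair br act"
    and "perfect_pairing p"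
    and "symmetric_trilinear C" and "\<exists>r s u. C r s u \<noteq> 0" and "invariant_cubic act C"
    and "symmetric_trilinear Cs" and "invariant_cubic (dual_act p act) Cs"
    and "dual_to_action br act p th"
    and "normalized act p C Cs th"
  shows "invariant_form (g_act act p C Cs) 4 (freudenthal_quartic p C Cs)"
proof -
  interpret normalized_cubics p C Cs act th
    using assms
    by (intro normalized_cubics.intro normalized_cubics_axioms.intro dual_cubics.intro)
      (simp_all add: freudenthal_pair_def lie_module_def cbilinear_def)
  obtain B :: "'w set" where "finite B" "cvs.independent B" "cvs.span B = UNIV"
    using freudenthal_pair_finite_basis[OF assms(1)] by blast
  then have "form 4 (freudenthal_quartic p C Cs)"
    by (intro form_freudenthal_quartic[OF finite_basis_coordinates])
  then show ?thesis
    by (simp add: invariant_form_def induced_derivation_quartic_g_act)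
qed

end
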